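(* Let $V$ be a finite-dimensional (real or complex) normed vector space. Suppose that $D$ is a convex domain of $V$ and $(D,d)$ is a metric space whose topology coincides with the norm topology and which satisfies $$d(sx+(1-s)y,z)\leq \max\{d(x,z),d(y,z)\}\quad\text{for all }x,y,z\in D\text{ and }s\in[0,1].$$ If $\{x_{n}\}$ and $\{y_{n}\}$ are sequences in $D$ converging (in norm) to $\xi$ and $\eta$, respectively, in $\partial D$ and if for some $w\in D$, $$d(x_{n},y_{n})-d(y_{n},w)\rightarrow-\infty,$$ then $[\xi,\eta]\subset\partial D$.
   Context: $\overline{D}$ is the norm closure of $D$ in $V$, $\partial D=\overline{D}\setminus D$, and $[\xi,\eta]=\{s\xi+(1-s)\eta:s\in[0,1]\}$. *)

theory Defs
  imports "HOL-Analysis.Analysis"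
begin

definition domain :: "'a::topological_space set \<Rightarrow> bool" where
  "domain D \<longleftrightarrow> D \<noteq> {} \<and> open D \<and> connected D"

(* A complex normed space is treated as the real normed space underlying it: the norm is
   the same, finite-dimensionality over the complex numbers and over the reals coincide,
   and convexity and segments only use real scalars.  So real_normed_vector covers both. *)
definition finite_dimensional :: "'a::real_normed_vector itself \<Rightarrow> bool" where
  "finite_dimensional _ \<longleftrightarrow>
     (\<exists>B. finite_dimensional_vector_space ((*\<^sub>R) :: real \<Rightarrow> 'a \<Rightarrow> 'a) B)"

(* The boundary as used for domains: for open D it agrees with the frontier of D. *)
definition boundary :: "'a::topological_space set \<Rightarrow> 'a set" where
  "boundary D = closure D - D"

end

theory Submission
  imports Defs
begin

text \<open>
  Suppose a point \<open>z = s \<xi> + (1 - s) \<eta>\<close> of the segment lay in \<open>D\<close>. The points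
  \<open>z\<^sub>n = s x\<^sub>n + (1 - s) y\<^sub>n\<close> of \<open>D\<close> tend to \<open>z\<close> in norm, hence also for \<open>d\<close>, since both
  induce the same topology on \<open>D\<close>; so \<open>d(z\<^sub>n, w)\<close> stays bounded. Quasiconvexity of
  \<open>d(\<cdot>, y\<^sub>n)\<close> on the segment from \<open>x\<^sub>n\<close> to \<open>y\<^sub>n\<close> gives
  \<open>d(z\<^sub>n, y\<^sub>n) \<le> max {d(x\<^sub>n, y\<^sub>n), 0} = d(x\<^sub>n, y\<^sub>n)\<close>, and the triangle inequality through
  \<open>z\<^sub>n\<close> then yields \<open>d(x\<^sub>n, y\<^sub>n) - d(y\<^sub>n, w) \<ge> - d(z\<^sub>n, w)\<close>, which is bounded below and
  contradicts the divergence to \<open>-\<infinity>\<close>. The segment does lie in the closure of \<open>D\<close>, because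
  the closure of a convex set is convex.
\<close>

theorem proposition4p3:
  fixes D :: "'a::real_normed_vector set"
    and d :: "'a \<Rightarrow> 'a \<Rightarrow> real"
    and x y :: "nat \<Rightarrow> 'a"
    and \<xi> \<eta> :: 'a
  assumes "finite_dimensional TYPE('a)"
    and "domain D" and "convex D"
    and "Metric_space D d"
    and "Metric_space.mtopology D d = top_of_set D"
    and "\<And>p q z s. \<lbrakk>p \<in> D; q \<in> D; z \<in> D; s \<in> {0..1}\<rbrakk> \<Longrightarrow>
           d (s *\<^sub>R p + (1 - s) *\<^sub>R q) z \<le> max (d p z) (d q z)"
    and "\<And>n. x n \<in> D" and "\<And>n. y n \<in> D"
    and "\<xi> \<in> boundary D" and "\<eta> \<in> boundary D"
    and "x \<longlonglongrightarrow> \<xi>" and "y \<longlonglongrightarrow> \<eta>"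
    and "\<exists>w\<in>D. filterlim (\<lambda>n. d (x n) (y n) - d (y n) w) at_bot sequentially"
  shows "closed_segment \<xi> \<eta> \<subseteq> boundary D"
proof
  interpret Metric_space D d by fact
  fix z assume "z \<in> closed_segment \<xi> \<eta>"
  then obtain s where s: "s \<in> {0..1}" and z: "z = s *\<^sub>R \<xi> + (1 - s) *\<^sub>R \<eta>"
    by (subst (asm) closed_segment_commute) (auto simp: closed_segment_def add.commute)
  have "z \<in> closure D"
    using assms(9,10) s convex_closure[OF \<open>convex D\<close>]
    by (auto simp: z boundary_def intro!: convexD)
  moreover have "z \<notin> D"
  proof
    assume "z \<in> D"
    obtain w where "w \<in> D"
      and div: "filterlim (\<lambda>n. d (x n) (y n) - d (y n) w) at_bot sequentially"
      using assms(13) by blast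
    define zs where "zs n = s *\<^sub>R x n + (1 - s) *\<^sub>R y n" for n
    have zs_in: "zs n \<in> D" for n
      using s assms(7,8) \<open>convex D\<close> by (auto simp: zs_def intro!: convexD)
    have "zs \<longlonglongrightarrow> z"
      unfolding zs_def z by (intro tendsto_intros assms)
    then have "limitin mtopology zs z sequentially"
      using \<open>z \<in> D\<close> zs_in by (simp add: assms(5) limitin_subtopology)
    then have "\<forall>\<^sub>F n in sequentially. zs n \<in> D \<and> d (zs n) z < 1"
      unfolding limitin_metric using zero_less_one by blast
    moreover have "\<forall>\<^sub>F n in sequentially. d (x n) (y n) - d (y n) w < - 1 - d z w"
      using div by (simp add: filterlim_at_bot_dense)
    ultimately have "\<forall>\<^sub>F n in sequentially. False"
    proof eventually_elim
      case (elim n)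
      have "d (zs n) (y n) \<le> max (d (x n) (y n)) (d (y n) (y n))"
        unfolding zs_def using assms(6-8) s by blast
      also have "\<dots> = d (x n) (y n)"
        using assms(8) by simp
      finally have "d (zs n) (y n) \<le> d (x n) (y n)" .
      moreover have "d (y n) w \<le> d (zs n) (y n) + d (zs n) w"
        using triangle[of "y n" "zs n" w] commute[of "y n" "zs n"] assms(8) zs_in \<open>w \<in> D\<close> by simp
      moreover have "d (zs n) w \<le> d (zs n) z + d z w"
        using triangle zs_in \<open>z \<in> D\<close> \<open>w \<in> D\<close> by blast
      ultimately show False
        using elim by linarith
    qed
    then show False by simp
  qed
  ultimately show "z \<in> boundary D"
    by (simp add: boundary_def)
qed

end
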